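(* Let $\alpha,\beta\in\alpha_0\mathbb{Z}$ with $|\alpha|,|\beta|<\frac1{\sqrt2}$. Then: (i) (adjoint relation, i.e. $(Y_\alpha(w)\otimes Y_\alpha(w^{-1}))^*=Y_{-\alpha}(w)\otimes Y_{-\alpha}(w^{-1})$ under $w^*=w^{-1}$) for all $s\in\mathbb{Z}$ and $\Psi_1,\Psi_2\in\mathcal D$, $\langle\Psi_1,\Phi_{\alpha,s}\Psi_2\rangle=\langle\Phi_{-\alpha,-s}\Psi_1,\Psi_2\rangle$; (ii) (weak commutativity) for all $m,n\in\mathbb{Z}$ and $\Psi_1,\Psi_2\in\mathcal D$, $$\langle\Phi_{-\alpha,-m}\Psi_1,\Phi_{\beta,n}\Psi_2\rangle=\langle\Phi_{-\beta,-n}\Psi_1,\Phi_{\alpha,m}\Psi_2\rangle,$$ i.e. $Y_\alpha(w)\otimes Y_\alpha(w^{-1})$ and $Y_\beta(z)\otimes Y_\beta(z^{-1})$ commute as sesquilinear forms on $\mathcal D$.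
   Context: For $\beta\in\mathbb{R}$ let $\mathcal H_\beta$ be the Hilbert space carrying a unitary representation of the Heisenberg algebra: operators $J_{\beta,n}$, $n\in\mathbb{Z}$, with $[J_{\beta,m},J_{\beta,n}]=m\,\delta_{m+n,0}$, $J_{\beta,n}^*=J_{\beta,-n}$, $J_{\beta,0}=\beta\cdot\mathbf 1$, and a cyclic unit vector $\Omega_\beta$ with $J_{\beta,n}\Omega_\beta=0$ for $n>0$; $\mathcal H_\beta$ is the closure of the span $\mathcal H_\beta^{\rm fin}$ of the vectors $J_{\beta,-n_1}\cdots J_{\beta,-n_k}\Omega_\beta$, $n_i>0$. Fix $\alpha_0\in\mathbb{R}$ with $0<|\alpha_0|\le1$ and set $\hat{\mathcal H}=\bigoplus_{j\in\mathbb{Z}}\mathcal H_{j\alpha_0}$, $\hat J_n=\bigoplus_j J_{j\alpha_0,n}$. For $\alpha\in\alpha_0\mathbb{Z}$ let $c_\alpha$ be the unitary on $\hat{\mathcal H}$ mapping $\mathcal H_\beta\to\mathcal H_{\beta+\alpha}$ by $c_\alpha \hat J_{-n_1}\cdots\hat J_{-n_k}\Omega_\beta=\hat J_{-n_1}\cdots\hat J_{-n_k}\Omega_{\beta+\alpha}$ ($n_i>0$). Define the formal series $E^{\pm}(\alpha,z)=\exp\bigl(\mp\sum_{n>0}\frac{\alpha\hat J_{\pm n}}{n}z^{\mp n}\bigr)$ and $Y_\alpha(z)=c_\alpha E^-(\alpha,z)E^+(\alpha,z)z^{\alpha\hat J_0}$, where $z^{\alpha\hat J_0}$ acts as $z^{\alpha\beta}$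 on $\mathcal H_\beta$. With $d=\alpha^2/2$ write $Y_\alpha(z)=\sum_{s\in\mathbb{R}}Y_{\alpha,s}z^{-s-d}$; the coefficient $Y_{\alpha,s}$ is a bounded operator (for $|\alpha|\le1$) mapping $\mathcal H_\beta$ into $\mathcal H_{\beta+\alpha}$, nonzero on $\mathcal H_\beta$ only for $s\in\mathbb{Z}-\alpha\beta-d$. The domain $\mathcal D$ is the algebraic direct sum $\bigoplus_{j\in\mathbb{Z},\mathrm{alg}}\mathcal H^{\rm fin}_{j\alpha_0}\otimes_{\mathrm{alg}}\mathcal H^{\rm fin}_{j\alpha_0}$. For $|\alpha|<1/\sqrt2$ and $s\in\mathbb{Z}$, $\Phi_{\alpha,s}$ denotes the operator on $\mathcal D$ given by the norm-convergent series $\Phi_{\alpha,s}\Psi=\sum_{t\in\mathbb{R}}(Y_{\alpha,t}\otimes Y_{\alpha,t-s})\Psi$; it is the coefficient of $w^{-s}$ in the formal series $Y_\alpha(w)\otimes Y_\alpha(w^{-1})$. *)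

theory Defs
  imports "HOL-Analysis.Analysis"
begin

text \<open>Concrete (Fock / bosonic) model of the Heisenberg representation.
  \<H>_\<beta> is realised on polynomials in variables x_1, x_2, ...:
  J_{-n} = multiplication by x_n, J_n = n d/dx_n (n > 0), Omega = 1.
  The monomial x^m = prod_n x_n^(m n) equals J_{-1}^(m 1) J_{-2}^(m 2) ... Omega.
  A partition is encoded by its multiplicity function m (m n = number of parts n).
  The monomials are orthogonal, with squared norm prod_n n^(m n) (m n)!.
  The sector of \<hat>\<H> with charge j*alpha0 is labelled by the integer j.\<close>

type_synonym part = "nat \<Rightarrow> nat"

definition valid_part :: "part \<Rightarrow> bool" where
  "valid_part m \<longleftrightarrow> m 0 = 0 \<and> finite {n. m n \<noteq> 0}"

definition pweight :: "part \<Rightarrow> nat" where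
  "pweight m = (\<Sum>n\<in>{n. m n \<noteq> 0}. n * m n)"

definition pnorm2 :: "part \<Rightarrow> real" where
  "pnorm2 m = (if valid_part m then (\<Prod>n\<in>{n. m n \<noteq> 0}. real n ^ m n * fact (m n)) else 0)"

text \<open>Coefficient of x^mu in E^-(alpha,z) E^+(alpha,z) x^lam (z-powers stripped).
  E^+ acts as the substitution x_n \<mapsto> x_n - alpha z^(-n), E^- as multiplication by
  exp(sum_n alpha x_n z^n / n).  Removing k_n factors x_n and adding p_n = mu_n + k_n - lam_n.\<close>
definition ycoef :: "real \<Rightarrow> part \<Rightarrow> part \<Rightarrow> real" where
  "ycoef \<alpha> lam mu =
    (\<Sum>k\<in>{k. \<forall>n. k n \<le> lam n \<and> lam n \<le> mu n + k n}.
       \<Prod>n\<in>{n. lam n \<noteq> 0 \<or> mu n \<noteq> 0}.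
          real (lam n choose k n) * (- \<alpha>) ^ k n
          * (\<alpha> / real n) ^ (mu n + k n - lam n) / fact (mu n + k n - lam n))"

text \<open>Matrix element of the mode Y_{alpha,s} (Y_alpha(z) = sum_s Y_{alpha,s} z^(-s-d),
  d = alpha^2/2) between basis monomials: coefficient of x^mu in sector j' of
  Y_{alpha,s} applied to x^lam in sector j (charge beta = j*alpha0).
  Y_alpha(z) x^lam = sum_mu ycoef alpha lam mu z^(alpha*beta + |mu| - |lam|) x^mu,
  and c_alpha shifts the charge by alpha.\<close>
definition Ymat :: "real \<Rightarrow> real \<Rightarrow> real \<Rightarrow> int \<times> part \<Rightarrow> int \<times> part \<Rightarrow> real" where
  "Ymat \<alpha>0 \<alpha> s jmu jlam =
    (let j' = fst jmu; mu = snd jmu; j = fst jlam; lam = snd jlam in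
     if valid_part mu \<and> valid_part lam \<and> of_int j' * \<alpha>0 = of_int j * \<alpha>0 + \<alpha>
        \<and> s = real (pweight lam) - real (pweight mu) - \<alpha> * (of_int j * \<alpha>0) - \<alpha>\<^sup>2 / 2
     then ycoef \<alpha> lam mu else 0)"

text \<open>Vectors of \<hat>\<H> \<otimes> \<hat>\<H> are given by their coefficients w.r.t. the orthogonal
  basis x^lam (sector j) \<otimes> x^lam' (sector j').\<close>
type_synonym tvec = "(int \<times> part) \<times> (int \<times> part) \<Rightarrow> complex"

definition Dom :: "tvec set" where
  "Dom = {\<Psi>. finite {b. \<Psi> b \<noteq> 0} \<and>
     (\<forall>b. \<Psi> b \<noteq> 0 \<longrightarrow> fst (fst b) = fst (snd b) \<and> valid_part (snd (fst b)) \<and> valid_part (snd (snd b)))}"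

definition tinner :: "tvec \<Rightarrow> tvec \<Rightarrow> complex" where
  "tinner u v = infsum (\<lambda>b. cnj (u b) * v b
       * complex_of_real (pnorm2 (snd (fst b)) * pnorm2 (snd (snd b)))) UNIV"

definition Phi :: "real \<Rightarrow> real \<Rightarrow> int \<Rightarrow> tvec \<Rightarrow> tvec" where
  "Phi \<alpha>0 \<alpha> s \<Psi> = (\<lambda>c. infsum (\<lambda>t::real.
      \<Sum>b\<in>{b. \<Psi> b \<noteq> 0}. complex_of_real (Ymat \<alpha>0 \<alpha> t (fst c) (fst b)
                                  * Ymat \<alpha>0 \<alpha> (t - of_int s) (snd c) (snd b)) * \<Psi> b) UNIV)"

end

theory Submission
  imports Defs "HOL-Real_Asymp.Real_Asymp"
begin

text \<open>
  Adjointness holds mode by mode: \<open>ycoef\<close> factors over the modes, and a factor is a coefficient of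
  $(y - a)^l \exp (a y / n)$.

  For weak commutativity, fix basis vectors \<open>nu\<close>, \<open>lam\<close> and let \<open>overlap a b nu lam N\<close> be the
  contribution of the intermediate states of weight \<open>N\<close> to the inner product of \<open>Y_a nu\<close> and
  \<open>Y_b lam\<close>. Commuting one oscillator through both vertex operators gives a recurrence in \<open>nu\<close> and
  \<open>lam\<close>, which reduces every overlap to finite combinations of shifts of the vacuum overlap, whose
  generating function is $(1 - x)^{-ab}$. For $|ab| < 1/2$ the vacuum overlap is square summable
  (Raabe), so a matrix element of the product of two tensor fields is an absolutely convergent
  correlation of two overlaps. Exchanging the two fields replaces \<open>(a, b)\<close> by \<open>(- b, - a)\<close>; the
  vacuum overlap depends only on \<open>ab\<close>, and the recurrences for the two orders are mirror images
  under reversal of the shifts. The reversals in the two tensor factors cancel because the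
  autocorrelation of the vacuum overlap is even.
\<close>

section \<open>Matrix coefficients of a vertex operator\<close>

definition ymode :: "nat \<Rightarrow> real \<Rightarrow> nat \<Rightarrow> nat \<Rightarrow> real" where
  "ymode n a l m = fps_nth ((fps_X - fps_const a) ^ l * fps_exp (a / real n)) m"

lemma ymode_eq_sum:
  "ymode n a l m = (\<Sum>k\<in>{k. k \<le> l \<and> l \<le> m + k}.
     real (l choose k) * (- a) ^ k * (a / real n) ^ (m + k - l) / fact (m + k - l))"
proof -
  have "(fps_X - fps_const a) ^ l = (fps_const (- a) + fps_X) ^ l"
    by (simp flip: fps_const_neg)
  also have "\<dots> = (\<Sum>k\<le>l. fps_const (real (l choose k) * (- a) ^ k) * fps_X ^ (l - k))"
    unfolding binomial_ring
    by (intro sum.cong refl)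
       (simp add: fps_const_power fps_of_nat flip: fps_const_mult fps_of_nat)
  finally have "ymode n a l m = (\<Sum>k\<le>l. real (l choose k) * (- a) ^ k *
      (if m < l - k then 0 else (a / real n) ^ (m - (l - k)) / fact (m - (l - k))))"
    unfolding ymode_def
    by (simp add: sum_distrib_right fps_sum_nth mult.assoc fps_X_power_mult_nth cong: if_cong)
  also have "\<dots> = (\<Sum>k\<in>{k. k \<le> l \<and> l \<le> m + k}.
     real (l choose k) * (- a) ^ k * (a / real n) ^ (m + k - l) / fact (m + k - l))"
    by (rule sum.mono_neutral_cong_right) auto
  finally show ?thesis .
qed

lemma ymode_0_0 [simp]: "ymode n a 0 0 = 1"
  by (simp add: ymode_def)

text \<open>One more factor \<open>X - a\<close>. This is the exchange of \<open>J_{-n}\<close> with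
  the vertex operator: \<open>Y J_{-n} = (J_{-n} - a) Y\<close> up to powers of
  \<open>z\<close>.\<close>

lemma ymode_Suc_left:
  "ymode n a (Suc l) m = (if m = 0 then 0 else ymode n a l (m - 1)) - a * ymode n a l m"
proof -
  have "(fps_X - fps_const a) ^ Suc l * fps_exp (a / real n)
      = fps_X * ((fps_X - fps_const a) ^ l * fps_exp (a / real n))
        - fps_const a * ((fps_X - fps_const a) ^ l * fps_exp (a / real n))"
    by (simp add: algebra_simps)
  then show ?thesis
    by (simp add: ymode_def)
qed

text \<open>The Leibniz rule for the derivative, that is \<open>J_n Y = Y J_n + a Y\<close> up to
  powers of \<open>z\<close>. The truncated \<open>l - 1\<close> at \<open>l = 0\<close> is
  harmless, being multiplied by \<open>l\<close>.\<close>

lemma ymode_Suc_right: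
  "real (Suc m) * ymode n a l (Suc m) = real l * ymode n a (l - 1) m + a / real n * ymode n a l m"
proof -
  let ?E = "fps_exp (a / real n)" and ?q = "fps_X - fps_const a"
  have "fps_deriv (?q ^ l * ?E) = fps_const (real l) * (?q ^ (l - 1) * ?E)
      + fps_const (a / real n) * (?q ^ l * ?E)"
    by (simp add: fps_deriv_power algebra_simps)
  then have "fps_nth (fps_deriv (?q ^ l * ?E)) m = real l * ymode n a (l - 1) m + a / real n * ymode n a l m"
    by (simp only: ymode_def fps_add_nth fps_mult_left_const_nth)
  then show ?thesis
    by (simp only: ymode_def fps_deriv_nth Suc_eq_plus1)
qed

text \<open>The weight \<open>n^m m!\<close> is the squared norm of \<open>x_n^m\<close>, for which
  multiplication by \<open>x_n\<close> and \<open>n d/dx_n\<close> are adjoint. So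
  \<open>ymode_Suc_left\<close> for charge \<open>a\<close> and \<open>ymode_Suc_right\<close> for
  charge \<open>- a\<close> give the same recursion in \<open>l\<close>.\<close>

lemma ymode_adjoint:
  assumes "n > 0"
  shows "ymode n a l m * (real n ^ m * fact m) = ymode n (- a) m l * (real n ^ l * fact l)"
proof (induction l arbitrary: m)
  case 0
  have "ymode n (- a) m 0 = a ^ m"
    by (induction m) (simp_all add: ymode_Suc_left)
  with assms show ?case
    by (simp add: ymode_def power_divide)
next
  case (Suc l)
  have rec: "real (Suc l) * real n * ymode n (- a) m (Suc l)
      = real m * real n * ymode n (- a) (m - 1) l - a * ymode n (- a) m l"
    using ymode_Suc_right[of l n "- a" m] assms by (simp add: field_simps)
  have "ymode n (- a) m (Suc l) * (real n ^ Suc l * fact (Suc l))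
      = (real (Suc l) * real n * ymode n (- a) m (Suc l)) * (real n ^ l * fact l)"
    by (simp add: algebra_simps)
  also have "\<dots> = real m * real n * (ymode n (- a) (m - 1) l * (real n ^ l * fact l))
      - a * (ymode n (- a) m l * (real n ^ l * fact l))"
    by (simp only: rec) (simp add: algebra_simps)
  also have "\<dots> = real m * real n * (ymode n a l (m - 1) * (real n ^ (m - 1) * fact (m - 1)))
      - a * (ymode n a l m * (real n ^ m * fact m))"
    by (simp only: Suc.IH)
  also have "\<dots> = ymode n a (Suc l) m * (real n ^ m * fact m)"
    by (cases m) (simp_all add: ymode_Suc_left algebra_simps)
  finally show ?case ..
qed

lemma ycoef_eq_prod:
  assumes S: "finite S" "{n. lam n \<noteq> 0} \<subseteq> S" "{n. mu n \<noteq> 0} \<subseteq> S"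
  shows "ycoef a lam mu = (\<Prod>n\<in>S. ymode n a (lam n) (mu n))"
proof -
  let ?S = "{n. lam n \<noteq> 0 \<or> mu n \<noteq> 0}"
  let ?B = "\<lambda>n. {k. k \<le> lam n \<and> lam n \<le> mu n + k}"
  let ?f = "\<lambda>n k. real (lam n choose k) * (- a) ^ k * (a / real n) ^ (mu n + k - lam n)
      / fact (mu n + k - lam n)"
  have fin: "finite ?S"
    by (rule finite_subset[OF _ S(1)]) (use S in auto)
  \<comment> \<open>The bound \<open>k n \<le> lam n\<close> forces \<open>k\<close> to vanish
    outside \<open>?S\<close>, so restriction to \<open>?S\<close> loses nothing and extension by 0
    inverts it. A sum over a product of finite sets then factors.\<close>
  have "ycoef a lam mu = (\<Sum>k\<in>Pi\<^sub>E ?S ?B. \<Prod>n\<in>?S. ?f n (k n))"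
    unfolding ycoef_def
    by (rule sum.reindex_bij_witness[where i = "\<lambda>g n. if n \<in> ?S then g n else 0"
          and j = "\<lambda>k. restrict k ?S"])
       (auto simp: fun_eq_iff PiE_iff extensional_def, metis bot_nat_0.extremum_uniqueI)
  also have "\<dots> = (\<Prod>n\<in>?S. \<Sum>k\<in>?B n. ?f n k)"
    by (rule prod_sum_PiE[symmetric]) (use fin in auto)
  also have "\<dots> = (\<Prod>n\<in>?S. ymode n a (lam n) (mu n))"
    by (simp only: ymode_eq_sum)
  also have "\<dots> = (\<Prod>n\<in>S. ymode n a (lam n) (mu n))"
    by (rule prod.mono_neutral_left) (use S in auto)
  finally show ?thesis .
qed

section \<open>Partitions: weights, norms, and recurrences for \<open>ycoef\<close>\<close>

lemma valid_part_zero [simp]: "valid_part (\<lambda>_. 0)"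
  by (simp add: valid_part_def)

lemma valid_part_upd:
  assumes "valid_part mu" "n > 0"
  shows "valid_part (mu(n := k))"
proof -
  have "{i. (mu(n := k)) i \<noteq> 0} \<subseteq> insert n {i. mu i \<noteq> 0}"
    by auto
  moreover have "finite (insert n {i. mu i \<noteq> 0})"
    using assms by (simp add: valid_part_def)
  ultimately have "finite {i. (mu(n := k)) i \<noteq> 0}"
    by (rule finite_subset)
  then show ?thesis
    using assms by (simp add: valid_part_def)
qed

lemma pweight_eq_sum:
  assumes "finite S" "{n. mu n \<noteq> 0} \<subseteq> S"
  shows "pweight mu = (\<Sum>n\<in>S. n * mu n)"
  unfolding pweight_def by (rule sum.mono_neutral_left) (use assms in auto)

lemma pnorm2_eq_prod:
  assumes "valid_part mu" "finite S" "{n. mu n \<noteq> 0} \<subseteq> S"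
  shows "pnorm2 mu = (\<Prod>n\<in>S. real n ^ mu n * fact (mu n))"
  using assms(1) unfolding pnorm2_def
  by (simp, intro prod.mono_neutral_left) (use assms in auto)

lemma pnorm2_nonneg: "pnorm2 mu \<ge> 0"
  by (auto simp: pnorm2_def intro!: prod_nonneg)

lemma pweight_zero [simp]: "pweight (\<lambda>_. 0) = 0"
  by (simp add: pweight_def)

lemma pweight_Suc:
  assumes "valid_part mu"
  shows "pweight (mu(n := Suc (mu n))) = pweight mu + n"
proof -
  define S where "S = insert n {i. mu i \<noteq> 0}"
  have fin: "finite S" and n: "n \<in> S" and sub: "{i. mu i \<noteq> 0} \<subseteq> S"
    using assms by (auto simp: valid_part_def S_def)
  have "pweight (mu(n := Suc (mu n))) = (\<Sum>i\<in>S. i * (mu(n := Suc (mu n))) i)"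
    by (rule pweight_eq_sum[OF fin]) (use sub n in auto)
  moreover have "pweight mu = (\<Sum>i\<in>S. i * mu i)"
    by (rule pweight_eq_sum[OF fin]) (use sub in auto)
  ultimately show ?thesis
    by (simp add: sum.remove[OF fin n])
qed

lemma pnorm2_Suc:
  assumes "valid_part mu" "n > 0"
  shows "pnorm2 (mu(n := Suc (mu n))) = real n * real (Suc (mu n)) * pnorm2 mu"
proof -
  define S where "S = insert n {i. mu i \<noteq> 0}"
  have fin: "finite S" and n: "n \<in> S" and sub: "{i. mu i \<noteq> 0} \<subseteq> S"
    using assms by (auto simp: valid_part_def S_def)
  have "pnorm2 (mu(n := Suc (mu n)))
      = (\<Prod>i\<in>S. real i ^ (mu(n := Suc (mu n))) i * fact ((mu(n := Suc (mu n))) i))"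
    by (rule pnorm2_eq_prod[OF valid_part_upd[OF assms] fin]) (use sub n in auto)
  moreover have "pnorm2 mu = (\<Prod>i\<in>S. real i ^ mu i * fact (mu i))"
    by (rule pnorm2_eq_prod[OF assms(1) fin]) (use sub in auto)
  ultimately show ?thesis
    by (simp add: prod.remove[OF fin n] algebra_simps)
qed

lemma ycoef_adjoint:
  assumes "valid_part lam" "valid_part mu"
  shows "ycoef a lam mu * pnorm2 mu = ycoef (- a) mu lam * pnorm2 lam"
proof -
  let ?S = "{i. lam i \<noteq> 0} \<union> {i. mu i \<noteq> 0}"
  have fin: "finite ?S" and pos: "\<And>i. i \<in> ?S \<Longrightarrow> i > 0"
    using assms by (auto simp: valid_part_def intro!: gr0I)
  have "ycoef a lam mu * pnorm2 mu
      = (\<Prod>n\<in>?S. ymode n a (lam n) (mu n) * (real n ^ mu n * fact (mu n)))"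
    using ycoef_eq_prod[OF fin, of lam mu a] pnorm2_eq_prod[OF assms(2) fin]
    by (simp add: prod.distrib)
  also have "\<dots> = (\<Prod>n\<in>?S. ymode n (- a) (mu n) (lam n) * (real n ^ lam n * fact (lam n)))"
    by (intro prod.cong refl ymode_adjoint pos)
  also have "\<dots> = ycoef (- a) mu lam * pnorm2 lam"
    using ycoef_eq_prod[OF fin, of mu lam "- a"] pnorm2_eq_prod[OF assms(1) fin]
    by (simp add: prod.distrib)
  finally show ?thesis .
qed

text \<open>The factors of modes other than \<open>n\<close> form a constant \<open>c\<close>
  independent of \<open>l\<close> and \<open>m\<close>; through it the one-mode recurrences lift to
  \<open>ycoef\<close>.\<close>

lemma ycoef_split_mode:
  assumes "valid_part lam" "valid_part mu" "n > 0"
  obtains c where "\<And>l m. ycoef a (lam(n := l)) (mu(n := m)) = ymode n a l m * c"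
proof -
  define S where "S = insert n ({i. lam i \<noteq> 0} \<union> {i. mu i \<noteq> 0})"
  have fin: "finite S" and n: "n \<in> S"
    using assms by (auto simp: valid_part_def S_def)
  have "ycoef a (lam(n := l)) (mu(n := m))
      = ymode n a l m * (\<Prod>i\<in>S - {n}. ymode i a (lam i) (mu i))" for l m
  proof -
    have "ycoef a (lam(n := l)) (mu(n := m))
        = (\<Prod>i\<in>S. ymode i a ((lam(n := l)) i) ((mu(n := m)) i))"
      by (rule ycoef_eq_prod[OF fin]) (auto simp: S_def)
    then show ?thesis
      by (simp add: prod.remove[OF fin n])
  qed
  then show thesis by (rule that)
qed

lemma ycoef_Suc_left:
  assumes "valid_part lam" "valid_part mu" "n > 0"
  shows "ycoef a (lam(n := Suc (lam n))) mu
    = (if mu n = 0 then 0 else ycoef a lam (mu(n := mu n - 1))) - a * ycoef a lam mu"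
proof -
  obtain c where c: "\<And>l m. ycoef a (lam(n := l)) (mu(n := m)) = ymode n a l m * c"
    using ycoef_split_mode[OF assms] by blast
  show ?thesis
    using c[of "Suc (lam n)" "mu n"] c[of "lam n" "mu n - 1"] c[of "lam n" "mu n"]
    by (simp add: ymode_Suc_left algebra_simps)
qed

lemma ycoef_Suc_right:
  assumes "valid_part nu" "valid_part mu" "n > 0"
  shows "real n * real (Suc (mu n)) * ycoef a nu (mu(n := Suc (mu n)))
    = real n * real (nu n) * ycoef a (nu(n := nu n - 1)) mu + a * ycoef a nu mu"
proof -
  obtain c where c: "\<And>l m. ycoef a (nu(n := l)) (mu(n := m)) = ymode n a l m * c"
    using ycoef_split_mode[OF assms] by blast
  have "real n * (real (Suc (mu n)) * ymode n a (nu n) (Suc (mu n))) * c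
      = real n * (real (nu n) * ymode n a (nu n - 1) (mu n) + a / real n * ymode n a (nu n) (mu n)) * c"
    by (simp only: ymode_Suc_right)
  then show ?thesis
    using c[of "nu n" "Suc (mu n)"] c[of "nu n - 1" "mu n"] c[of "nu n" "mu n"] assms(3)
    by (simp add: algebra_simps)
qed

text \<open>States are built from the vacuum by one oscillator at a time. Removing a part
  \<open>n > 0\<close> strictly lowers the weight, which justifies the induction.\<close>

lemma valid_part_induct [consumes 1, case_names zero Suc]:
  assumes "valid_part mu"
    and "P (\<lambda>_. 0)"
    and step: "\<And>mu n. valid_part mu \<Longrightarrow> n > 0 \<Longrightarrow> P mu \<Longrightarrow> P (mu(n := Suc (mu n)))"
  shows "P mu"
  using assms(1)
proof (induction "pweight mu" arbitrary: mu rule: less_induct)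
  case less
  show ?case
  proof (cases "\<exists>n. mu n \<noteq> 0")
    case False
    then have "mu = (\<lambda>_. 0)" by auto
    then show ?thesis using assms(2) by simp
  next
    case True
    then obtain n where n: "mu n \<noteq> 0" by blast
    with less.prems have "n > 0"
      by (auto simp: valid_part_def intro!: gr0I)
    define nu where "nu = mu(n := mu n - 1)"
    have mu: "mu = nu(n := Suc (nu n))" and valid: "valid_part nu"
      using n valid_part_upd[OF less.prems \<open>n > 0\<close>] by (auto simp: nu_def)
    have "pweight nu < pweight mu"
      using pweight_Suc[OF valid, of n] \<open>n > 0\<close> by (simp flip: mu)
    then show ?thesis
      using less.hyps valid step[OF valid \<open>n > 0\<close>] mu by metis
  qed
qed

text \<open>The weight is an integer so that \<open>parts (N - int n)\<close> is empty, not
  truncated, when \<open>n\<close> exceeds \<open>N\<close>; shifts of \<open>N\<close> then need no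
  case distinction.\<close>

definition parts :: "int \<Rightarrow> part set" where
  "parts N = {mu. valid_part mu \<and> int (pweight mu) = N}"

lemma finite_parts: "finite (parts N)"
proof (rule finite_subset)
  show "parts N
      \<subseteq> {f. \<forall>x. (x \<in> {..nat N} \<longrightarrow> f x \<in> {..nat N}) \<and> (x \<notin> {..nat N} \<longrightarrow> f x = 0)}"
  unfolding parts_def
  proof clarify
    fix mu i
    assume mu: "valid_part mu" and N: "N = int (pweight mu)"
    have le: "mu i \<noteq> 0 \<Longrightarrow> i * mu i \<le> pweight mu"
      unfolding pweight_def using mu
      by (intro member_le_sum) (auto simp: valid_part_def)
    have pos: "mu i \<noteq> 0 \<Longrightarrow> i > 0"
      using mu by (auto simp: valid_part_def intro!: gr0I)
    have "mu i \<noteq> 0 \<Longrightarrow> mu i \<le> pweight mu \<and> i \<le> pweight mu"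
      using le pos by (cases "mu i"; cases i) auto
    then show "(i \<in> {..nat (int (pweight mu))} \<longrightarrow> mu i \<in> {..nat (int (pweight mu))})
        \<and> (i \<notin> {..nat (int (pweight mu))} \<longrightarrow> mu i = 0)"
      by (cases "mu i = 0") auto
  qed
qed (rule finite_set_of_finite_funs, auto)

section \<open>Overlaps at fixed weight\<close>

text \<open>Removing one part \<open>n\<close> is a bijection from the partitions of
  \<open>N\<close> that contain \<open>n\<close> to all partitions of \<open>N - n\<close>.\<close>

lemma sum_parts_shift:
  fixes h :: "part \<Rightarrow> 'a::comm_monoid_add"
  assumes n: "n > 0" and h: "\<And>mu. mu n = 0 \<Longrightarrow> h mu = 0"
  shows "(\<Sum>mu\<in>parts N. h mu) = (\<Sum>mu\<in>parts (N - int n). h (mu(n := Suc (mu n))))"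
proof -
  have "(\<Sum>mu\<in>parts N. h mu) = (\<Sum>mu\<in>{mu\<in>parts N. mu n \<noteq> 0}. h mu)"
    by (rule sum.mono_neutral_right[OF finite_parts]) (use h in auto)
  also have "\<dots> = (\<Sum>mu\<in>parts (N - int n). h (mu(n := Suc (mu n))))"
  proof (rule sum.reindex_bij_witness[where i = "\<lambda>mu. mu(n := Suc (mu n))"
        and j = "\<lambda>mu. mu(n := mu n - 1)"])
    fix mu assume "mu \<in> {mu\<in>parts N. mu n \<noteq> 0}"
    then have mu: "valid_part mu" "int (pweight mu) = N" "mu n \<noteq> 0"
      by (auto simp: parts_def)
    define nu where "nu = mu(n := mu n - 1)"
    have nu: "valid_part nu" "mu = nu(n := Suc (nu n))"
      using mu valid_part_upd[OF mu(1) n] by (auto simp: nu_def)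
    have "int (pweight nu) = N - int n"
      using pweight_Suc[OF nu(1), of n] mu(2) nu(2) by simp
    then show "mu(n := mu n - 1) \<in> parts (N - int n)"
      using nu(1) by (simp add: parts_def nu_def)
    show "(mu(n := mu n - 1))(n := Suc ((mu(n := mu n - 1)) n)) = mu"
      using mu by auto
    then show "h ((mu(n := mu n - 1))(n := Suc ((mu(n := mu n - 1)) n))) = h mu"
      by simp
  next
    fix mu assume "mu \<in> parts (N - int n)"
    then have "valid_part mu" "int (pweight mu) = N - int n"
      by (auto simp: parts_def)
    then show "mu(n := Suc (mu n)) \<in> {mu\<in>parts N. mu n \<noteq> 0}"
      using n by (simp add: parts_def valid_part_upd pweight_Suc)
    show "(mu(n := Suc (mu n)))(n := (mu(n := Suc (mu n))) n - 1) = mu"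
      by auto
  qed
  finally show ?thesis .
qed

definition overlap :: "real \<Rightarrow> real \<Rightarrow> part \<Rightarrow> part \<Rightarrow> int \<Rightarrow> real" where
  "overlap a b nu lam N = (\<Sum>mu\<in>parts N. ycoef a nu mu * ycoef b lam mu * pnorm2 mu)"

lemma overlap_commute: "overlap a b nu lam = overlap b a lam nu"
  by (auto simp: overlap_def fun_eq_iff mult_ac intro!: sum.cong)

text \<open>The added oscillator \<open>J_{-n}\<close> passes through the right vertex operator,
  leaving \<open>- b\<close>. It then acts as its adjoint \<open>J_n\<close> on the other side,
  where it lowers the weight of the intermediate states by \<open>n\<close>, passes through the left
  vertex operator leaving \<open>a\<close>, and hits \<open>nu\<close>.\<close>

lemma overlap_Suc:
  assumes "valid_part nu" "valid_part lam" "n > 0"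
  shows "overlap a b nu (lam(n := Suc (lam n))) N
    = real n * real (nu n) * overlap a b (nu(n := nu n - 1)) lam (N - int n)
      + a * overlap a b nu lam (N - int n) - b * overlap a b nu lam N"
proof -
  let ?g = "\<lambda>mu. if mu n = 0 then 0 else ycoef b lam (mu(n := mu n - 1))"
  have "overlap a b nu (lam(n := Suc (lam n))) N
      = (\<Sum>mu\<in>parts N. ycoef a nu mu * (?g mu - b * ycoef b lam mu) * pnorm2 mu)"
    unfolding overlap_def
    by (intro sum.cong refl) (simp add: parts_def ycoef_Suc_left[OF assms(2) _ assms(3)])
  also have "\<dots> = (\<Sum>mu\<in>parts N. ycoef a nu mu * ?g mu * pnorm2 mu) - b * overlap a b nu lam N"
    unfolding overlap_def sum_distrib_left sum_subtractf[symmetric]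
    by (intro sum.cong refl) (simp add: algebra_simps)
  also have "(\<Sum>mu\<in>parts N. ycoef a nu mu * ?g mu * pnorm2 mu)
      = (\<Sum>mu\<in>parts (N - int n). ycoef a nu (mu(n := Suc (mu n))) * ycoef b lam mu
          * pnorm2 (mu(n := Suc (mu n))))"
    by (subst sum_parts_shift[OF assms(3)]) auto
  also have "\<dots> = (\<Sum>mu\<in>parts (N - int n).
      (real n * real (nu n) * ycoef a (nu(n := nu n - 1)) mu + a * ycoef a nu mu)
        * ycoef b lam mu * pnorm2 mu)"
  proof (intro sum.cong refl)
    fix mu assume "mu \<in> parts (N - int n)"
    then have mu: "valid_part mu" by (simp add: parts_def)
    show "ycoef a nu (mu(n := Suc (mu n))) * ycoef b lam mu * pnorm2 (mu(n := Suc (mu n)))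
        = (real n * real (nu n) * ycoef a (nu(n := nu n - 1)) mu + a * ycoef a nu mu)
          * ycoef b lam mu * pnorm2 mu"
      unfolding ycoef_Suc_right[OF assms(1) mu assms(3), symmetric] pnorm2_Suc[OF mu assms(3)]
      by (simp add: algebra_simps)
  qed
  also have "\<dots> = real n * real (nu n) * overlap a b (nu(n := nu n - 1)) lam (N - int n)
      + a * overlap a b nu lam (N - int n)"
    unfolding overlap_def sum_distrib_left sum.distrib[symmetric]
    by (intro sum.cong refl) (simp add: algebra_simps)
  finally show ?thesis .
qed

lemma pweight_eq_sum_atMost:
  assumes "valid_part mu" "pweight mu \<le> M"
  shows "pweight mu = (\<Sum>n=1..M. n * mu n)"
proof (rule pweight_eq_sum)
  show "{n. mu n \<noteq> 0} \<subseteq> {1..M}"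
  proof
    fix i assume "i \<in> {n. mu n \<noteq> 0}"
    then have "mu i \<noteq> 0" "i > 0" using assms(1) by (auto simp: valid_part_def intro!: gr0I)
    moreover have "i * mu i \<le> pweight mu"
      unfolding pweight_def using assms(1) \<open>mu i \<noteq> 0\<close>
      by (intro member_le_sum) (auto simp: valid_part_def)
    ultimately show "i \<in> {1..M}"
      using assms(2) by (cases "mu i") auto
  qed
qed simp

lemma overlap_neg: "N < 0 \<Longrightarrow> overlap a b nu lam N = 0"
  by (simp add: overlap_def parts_def)

section \<open>The vacuum overlap\<close>

definition vacuum :: "real \<Rightarrow> real \<Rightarrow> int \<Rightarrow> real" where
  "vacuum a b = overlap a b (\<lambda>_. 0) (\<lambda>_. 0)"

lemma vacuum_0: "vacuum a b 0 = 1"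
proof -
  have "mu = (\<lambda>_. 0)" if "valid_part mu" "pweight mu = 0" for mu
    using that by (induction rule: valid_part_induct) (auto simp: pweight_Suc)
  then have "parts 0 = {\<lambda>_. 0}"
    by (auto simp: parts_def)
  then show ?thesis
    by (simp add: vacuum_def overlap_def pnorm2_def ycoef_eq_prod[of "{}"])
qed

text \<open>Write \<open>M\<close> as the sum of \<open>n * mu n\<close> over the fixed range
  \<open>1..M\<close> and swap sums; removing a part \<open>n\<close> yields \<open>a * b\<close>
  times the overlap at \<open>M - n\<close>. For the generating function \<open>F\<close> this says
  \<open>x F' = a b x / (1 - x) F\<close>, so \<open>F = (1 - x)^(-ab)\<close>.\<close>

lemma vacuum_sum:
  "real M * vacuum a b (int M) = a * b * (\<Sum>j<M. vacuum a b (int j))"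
proof -
  let ?h = "\<lambda>mu. ycoef a (\<lambda>_. 0) mu * ycoef b (\<lambda>_. 0) mu * pnorm2 mu"
  have "real M * vacuum a b (int M) = (\<Sum>mu\<in>parts (int M). (\<Sum>n=1..M. real n * real (mu n)) * ?h mu)"
    unfolding vacuum_def overlap_def sum_distrib_left
  proof (intro sum.cong refl)
    fix mu assume "mu \<in> parts (int M)"
    then have "valid_part mu" "pweight mu = M"
      by (auto simp: parts_def)
    then have "real (pweight mu) = real (\<Sum>n=1..M. n * mu n)"
      by (subst pweight_eq_sum_atMost[of mu M]) auto
    also have "\<dots> = (\<Sum>n=1..M. real n * real (mu n))"
      by simp
    finally show "real M * ?h mu = (\<Sum>n=1..M. real n * real (mu n)) * ?h mu"
      by (simp only: \<open>pweight mu = M\<close>)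
  qed
  also have "\<dots> = (\<Sum>n=1..M. \<Sum>mu\<in>parts (int M). real n * real (mu n) * ?h mu)"
    unfolding sum_distrib_right by (rule sum.swap)
  also have "\<dots> = (\<Sum>n=1..M. a * b * vacuum a b (int (M - n)))"
  proof (intro sum.cong refl)
    fix n assume n: "n \<in> {1..M}"
    then have pos: "n > 0" by simp
    have "(\<Sum>mu\<in>parts (int M). real n * real (mu n) * ?h mu)
        = (\<Sum>mu\<in>parts (int M - int n). real n * real (Suc (mu n)) * ?h (mu(n := Suc (mu n))))"
      by (subst sum_parts_shift[OF pos]) auto
    also have "\<dots> = (\<Sum>mu\<in>parts (int M - int n). a * b * ?h mu)"
    proof (intro sum.cong refl)
      fix mu assume "mu \<in> parts (int M - int n)"
      then have mu: "valid_part mu" by (simp add: parts_def)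
      have rec: "real n * real (Suc (mu n)) * ycoef c (\<lambda>_. 0) (mu(n := Suc (mu n)))
          = c * ycoef c (\<lambda>_. 0) mu" for c
        using ycoef_Suc_right[OF valid_part_zero mu pos, of c] by simp
      \<comment> \<open>The norm of the enlarged partition contributes a second factor
        \<open>n * Suc (mu n)\<close>, so each of the two coefficients receives the one it needs for
        \<open>rec\<close>.\<close>
      have "real n * real (Suc (mu n)) * ?h (mu(n := Suc (mu n)))
          = (real n * real (Suc (mu n)) * ycoef a (\<lambda>_. 0) (mu(n := Suc (mu n))))
            * (real n * real (Suc (mu n)) * ycoef b (\<lambda>_. 0) (mu(n := Suc (mu n)))) * pnorm2 mu"
        unfolding pnorm2_Suc[OF mu pos] by (simp add: mult_ac)
      also have "\<dots> = a * b * ?h mu"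
        unfolding rec by (simp add: mult_ac)
      finally show "real n * real (Suc (mu n)) * ?h (mu(n := Suc (mu n))) = a * b * ?h mu" .
    qed
    also have "\<dots> = a * b * vacuum a b (int (M - n))"
      using n by (simp add: vacuum_def overlap_def sum_distrib_left of_nat_diff)
    finally show "(\<Sum>mu\<in>parts (int M). real n * real (mu n) * ?h mu)
        = a * b * vacuum a b (int (M - n))" .
  qed
  also have "\<dots> = a * b * (\<Sum>j<M. vacuum a b (int j))"
    unfolding sum_distrib_left
    by (rule sum.reindex_bij_witness[where i = "\<lambda>j. M - j" and j = "\<lambda>n. M - n"]) auto
  finally show ?thesis .
qed

text \<open>Difference of two consecutive instances of \<open>vacuum_sum\<close>: the partial sums
  differ by the single term at \<open>M\<close>.\<close>

lemma vacuum_Suc: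
  "real (Suc M) * vacuum a b (int (Suc M)) = (real M + a * b) * vacuum a b (int M)"
  using vacuum_sum[of "Suc M" a b] vacuum_sum[of M a b] by (simp add: algebra_simps)

lemma vacuum_cong:
  assumes "a * b = a' * b'"
  shows "vacuum a b = vacuum a' b'"
proof
  fix N
  have "vacuum a b (int M) = vacuum a' b' (int M)" for M
  proof (induction M)
    case (Suc M)
    then have "real (Suc M) * vacuum a b (int (Suc M)) = real (Suc M) * vacuum a' b' (int (Suc M))"
      unfolding vacuum_Suc assms by simp
    then show ?case by (simp del: of_nat_Suc)
  qed (simp add: vacuum_0)
  then show "vacuum a b N = vacuum a' b' N"
    by (cases "N < 0") (metis overlap_neg vacuum_def, metis int_nat_eq not_less)
qed

section \<open>Square summability and correlations\<close>

lemma has_sum_sum: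
  fixes f :: "'i \<Rightarrow> 'a \<Rightarrow> 'b::topological_comm_monoid_add"
  assumes "finite I" "\<And>i. i \<in> I \<Longrightarrow> (f i has_sum s i) A"
  shows "((\<lambda>x. \<Sum>i\<in>I. f i x) has_sum (\<Sum>i\<in>I. s i)) A"
  using assms by (induction rule: finite_induct) (auto intro!: has_sum_add)

definition l2 :: "(int \<Rightarrow> real) \<Rightarrow> bool" where
  "l2 u \<longleftrightarrow> (\<lambda>N. (u N)\<^sup>2) summable_on UNIV"

lemma l2_cmult: "l2 u \<Longrightarrow> l2 (\<lambda>N. c * u N)"
  unfolding l2_def power_mult_distrib by (rule summable_on_cmult_right)

lemma l2_add:
  assumes "l2 u" "l2 v"
  shows "l2 (\<lambda>N. u N + v N)"
  unfolding l2_def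
proof (rule summable_on_comparison_test)
  show "(\<lambda>N. 2 * (u N)\<^sup>2 + 2 * (v N)\<^sup>2) summable_on UNIV"
    using assms unfolding l2_def by (intro summable_on_add summable_on_cmult_right)
  show "(u N + v N)\<^sup>2 \<le> 2 * (u N)\<^sup>2 + 2 * (v N)\<^sup>2" for N
    using sum_squares_bound[of "u N" "v N"] by (simp add: power2_sum)
qed simp

lemma l2_shift:
  assumes "l2 u"
  shows "l2 (\<lambda>N. u (N - k))"
proof -
  have "bij (\<lambda>N::int. N - k)"
    by (rule bij_betw_byWitness[where f' = "\<lambda>N. N + k"]) auto
  from summable_on_reindex_bij_betw[OF this, of "\<lambda>N. (u N)\<^sup>2"] show ?thesis
    using assms by (simp add: l2_def)
qed

lemma l2_mult_summable:
  assumes "l2 u" "l2 v"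
  shows "(\<lambda>N. u N * v N) summable_on UNIV"
proof (rule abs_summable_summable, rule summable_on_comparison_test)
  show "(\<lambda>N. (u N)\<^sup>2 + (v N)\<^sup>2) summable_on UNIV"
    using assms unfolding l2_def by (rule summable_on_add)
  show "norm (u N * v N) \<le> (u N)\<^sup>2 + (v N)\<^sup>2" for N
    using sum_squares_bound[of "\<bar>u N\<bar>" "\<bar>v N\<bar>"]
      mult_nonneg_nonneg[OF abs_ge_zero abs_ge_zero, of "u N" "v N"]
    unfolding real_norm_def abs_mult power2_abs by linarith
qed simp

text \<open>This is the cross-correlation of \<open>u\<close> and \<open>v\<close> at lag
  \<open>k\<close>, not their convolution: the argument of \<open>v\<close> is
  \<open>N - k\<close>.\<close>

definition conv :: "(int \<Rightarrow> real) \<Rightarrow> (int \<Rightarrow> real) \<Rightarrow> int \<Rightarrow> real" where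
  "conv u v k = (\<Sum>\<^sub>\<infinity>N. u N * v (N - k))"

lemma conv_commute: "conv u v k = conv v u (- k)"
  unfolding conv_def
  by (rule infsum_reindex_bij_witness[where i = "\<lambda>N. N + k" and j = "\<lambda>N. N - k"])
     (auto simp: mult.commute)

lemma has_sum_conv:
  assumes "l2 u" "l2 v"
  shows "((\<lambda>N. u N * v (N - k)) has_sum conv u v k) UNIV"
  unfolding conv_def by (intro has_sum_infsum l2_mult_summable l2_shift assms)

lemma has_sum_conv_shift:
  assumes "l2 u" "l2 v"
  shows "((\<lambda>N. u (N - n) * v (N - k)) has_sum conv u v (k - n)) UNIV"
proof -
  have bij: "bij (\<lambda>N::int. N - n)"
    by (rule bij_betw_byWitness[where f' = "\<lambda>N. N + n"]) auto
  show ?thesis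
    using has_sum_reindex_bij_betw[OF bij, of "\<lambda>N. u N * v (N - (k - n))" "conv u v (k - n)"]
      has_sum_conv[OF assms, of "k - n"] by (simp add: algebra_simps)
qed

section \<open>Square summability of the overlaps\<close>

lemma l2_vacuum:
  assumes "\<bar>a * b\<bar> < 1 / 2"
  shows "l2 (vacuum a b)"
proof -
  let ?f = "\<lambda>M::nat. (vacuum a b (int M))\<^sup>2"
  have "summable ?f"
  \<comment> \<open>Raabe's test divides by the terms, and for \<open>a * b = 0\<close> all terms
    beyond the first vanish.\<close>
  proof (cases "a * b = 0")
    case True
    have "vacuum a b (int M) = 0" if "M \<ge> 1" for M
    proof -
      have "vacuum a b (int (Suc K)) = 0" for K
      proof (induction K)
        case 0
        then show ?case using vacuum_Suc[of 0 a b] True by simp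
      next
        case (Suc K)
        then show ?case using vacuum_Suc[of "Suc K" a b] by simp
      qed
      with that show ?thesis by (cases M) auto
    qed
    then show ?thesis
      by (intro summable_finite[of "{0}"]) (auto simp: Suc_le_eq)
  next
    case False
    define c where "c = a * b"
    have c: "\<bar>c\<bar> < 1 / 2" "c \<noteq> 0" using assms False by (auto simp: c_def)
    \<comment> \<open>No factor of the recurrence vanishes: \<open>c \<noteq> 0\<close> covers
      \<open>M = 0\<close>, and \<open>c > - 1 / 2\<close> covers \<open>M \<ge> 1\<close>.\<close>
    have nz: "real M + c \<noteq> 0" for M
      using c by (cases M) (auto simp: abs_if split: if_splits)
    have pos: "vacuum a b (int M) \<noteq> 0" for M
    proof (induction M)
      case (Suc M)
      then show ?case using vacuum_Suc[of M a b] nz[of M] by (auto simp: c_def)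
    qed (simp add: vacuum_0)
    have ratio: "?f M / ?f (Suc M) = ((real M + 1) / (real M + c))\<^sup>2" for M
    proof -
      have "vacuum a b (int (Suc M)) = (real M + c) / (real M + 1) * vacuum a b (int M)"
        using vacuum_Suc[of M a b] by (simp add: c_def field_simps)
      then show ?thesis
        using pos[of M] by (simp add: power_mult_distrib power_divide)
    qed
    \<comment> \<open>The Raabe limit \<open>2 * (1 - c)\<close> exceeds 1 exactly when
      \<open>c < 1 / 2\<close>, which is where the bound on \<open>a * b\<close> enters.\<close>
    have "(\<lambda>M. real M * (((real M + 1) / (real M + c))\<^sup>2 - 1)) \<longlonglongrightarrow> 2 * (1 - c)"
      by real_asymp
    then have "(\<lambda>M. ereal (real M * (?f M / ?f (Suc M) - 1))) \<longlonglongrightarrow> ereal (2 * (1 - c))"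
      unfolding ratio by simp
    then have "liminf (\<lambda>M. ereal (real M * (?f M / ?f (Suc M) - 1))) = ereal (2 * (1 - c))"
      by (intro lim_imp_Liminf) auto
    moreover have "ereal (2 * (1 - c)) > 1"
      using c(1) by (auto simp: one_ereal_def abs_if split: if_splits)
    ultimately show ?thesis
      by (intro raabes_test_convergence) (use pos in auto)
  qed
  then have "?f summable_on UNIV"
    by (rule summable_nonneg_imp_summable_on) auto
  then have "(\<lambda>N. (vacuum a b N)\<^sup>2) summable_on range int"
    by (subst summable_on_reindex) (auto simp: o_def)
  then show ?thesis
    unfolding l2_def
  proof (subst summable_on_cong_neutral)
    fix N :: int assume "N \<in> UNIV - range int"
    then have "N < 0" by (metis DiffD2 int_nat_eq linorder_not_le rangeI)
    then show "(vacuum a b N)\<^sup>2 = 0" by (simp add: vacuum_def overlap_neg)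
  qed auto
qed

lemma l2_overlap_Suc:
  assumes "valid_part nu" "valid_part lam" "n > 0"
    and "l2 (overlap a b nu lam)" "l2 (overlap a b (nu(n := nu n - 1)) lam)"
  shows "l2 (overlap a b nu (lam(n := Suc (lam n))))"
proof -
  have "l2 (\<lambda>N. real n * real (nu n) * overlap a b (nu(n := nu n - 1)) lam (N - int n)
      + a * overlap a b nu lam (N - int n) + (- b) * overlap a b nu lam N)"
    by (intro l2_add l2_cmult l2_shift[of "overlap a b nu lam"]
        l2_shift[of "overlap a b (nu(n := nu n - 1)) lam"] assms)
  then show ?thesis
    by (simp add: overlap_Suc[OF assms(1-3), abs_def])
qed

text \<open>\<open>overlap_Suc\<close> writes each overlap as a combination of shifts of simpler
  ones, down to the vacuum. The induction on \<open>lam\<close> keeps \<open>nu\<close> arbitrary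
  because the recurrence also lowers \<open>nu\<close>.\<close>

lemma l2_overlap:
  assumes "\<bar>a * b\<bar> < 1 / 2" "valid_part nu" "valid_part lam"
  shows "l2 (overlap a b nu lam)"
  using assms(3,2)
proof (induction lam arbitrary: nu rule: valid_part_induct)
  case zero
  then show ?case
  proof (induction rule: valid_part_induct)
    case zero
    then show ?case using l2_vacuum[OF assms(1)] by (simp add: vacuum_def)
  next
    case (Suc nu n)
    \<comment> \<open>After exchanging the roles of the two states, the lowered state is the vacuum.
      There \<open>0 - 1 = 0\<close> makes the second premise of \<open>l2_overlap_Suc\<close>
      coincide with the first.\<close>
    then have "l2 (overlap b a (\<lambda>_. 0) (nu(n := Suc (nu n))))"
      by (intro l2_overlap_Suc) (auto simp: overlap_commute[of b a "\<lambda>_. 0"] fun_upd_idem)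
    then show ?case by (subst overlap_commute)
  qed
next
  case (Suc lam n)
  show ?case
    by (intro l2_overlap_Suc Suc valid_part_upd)
qed

section \<open>Exchanging the charges in a correlation\<close>

lemma conv_overlap_Suc:
  assumes ab: "\<bar>a * b\<bar> < 1 / 2" and v: "l2 v"
    and valid: "valid_part nu" "valid_part lam" "n > 0"
  shows "conv (overlap a b nu (lam(n := Suc (lam n)))) v k
    = real n * real (nu n) * conv (overlap a b (nu(n := nu n - 1)) lam) v (k - int n)
      + a * conv (overlap a b nu lam) v (k - int n) - b * conv (overlap a b nu lam) v k"
proof -
  have u: "l2 (overlap a b nu lam)" "l2 (overlap a b (nu(n := nu n - 1)) lam)"
    by (intro l2_overlap ab valid valid_part_upd)+
  have "((\<lambda>N. real n * real (nu n) * (overlap a b (nu(n := nu n - 1)) lam (N - int n) * v (N - k))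
      + a * (overlap a b nu lam (N - int n) * v (N - k))
      + (- b) * (overlap a b nu lam N * v (N - k))) has_sum
      (real n * real (nu n) * conv (overlap a b (nu(n := nu n - 1)) lam) v (k - int n)
      + a * conv (overlap a b nu lam) v (k - int n) + (- b) * conv (overlap a b nu lam) v k)) UNIV"
    by (intro has_sum_add has_sum_cmult_right has_sum_conv has_sum_conv_shift u v)
  from infsumI[OF this] show ?thesis
    unfolding conv_def[of "overlap a b nu (lam(n := Suc (lam n)))"] overlap_Suc[OF valid]
    by (simp add: algebra_simps)
qed

text \<open>The reflection of lags survives adding an oscillator. For \<open>(a, b)\<close> the
  recurrence has \<open>a\<close> at lag \<open>k - n\<close> and \<open>- b\<close> at lag
  \<open>k\<close>; for \<open>(- b, - a)\<close> it has \<open>a\<close> at \<open>K + n\<close>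
  and \<open>- b\<close> at \<open>K\<close>. Reflection matches these pairs. The term with lowered
  \<open>nu\<close> also lands on \<open>K\<close>, since its weight is smaller by \<open>n\<close>.
  The offset \<open>T\<close> stands for the weights behind the second sequence.\<close>

lemma conv_overlap_swap_Suc:
  assumes ab: "\<bar>a * b\<bar> < 1 / 2" and v: "l2 v" "l2 v'"
    and valid: "valid_part nu" "valid_part lam" "n > 0"
    and IH: "\<And>k. conv (overlap a b nu lam) v k
      = conv (overlap (- b) (- a) nu lam) v' (int (pweight nu) + int (pweight lam) - T - k)"
    and IH': "\<And>k. nu n \<noteq> 0 \<Longrightarrow> conv (overlap a b (nu(n := nu n - 1)) lam) v k
      = conv (overlap (- b) (- a) (nu(n := nu n - 1)) lam) v'
          (int (pweight (nu(n := nu n - 1))) + int (pweight lam) - T - k)"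
  shows "conv (overlap a b nu (lam(n := Suc (lam n)))) v k
      = conv (overlap (- b) (- a) nu (lam(n := Suc (lam n)))) v'
          (int (pweight nu) + int (pweight (lam(n := Suc (lam n)))) - T - k)"
proof -
  have ab': "\<bar>(- b) * (- a)\<bar> < 1 / 2" using ab by (simp add: mult.commute)
  define K where "K = int (pweight nu) + int (pweight lam) - T - k"
  have "real (nu n) * conv (overlap a b (nu(n := nu n - 1)) lam) v (k - int n)
      = real (nu n) * conv (overlap (- b) (- a) (nu(n := nu n - 1)) lam) v' K"
  proof (cases "nu n = 0")
    case False
    have valid': "valid_part (nu(n := nu n - 1))" by (intro valid_part_upd valid)
    have "int (pweight (nu(n := nu n - 1))) + int (pweight lam) - T - (k - int n) = K"
      using pweight_Suc[OF valid', of n] False by (simp add: K_def)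
    then show ?thesis
      by (simp only: IH'[OF False, of "k - int n"])
  qed simp
  moreover have "conv (overlap a b nu lam) v (k - int n) = conv (overlap (- b) (- a) nu lam) v' (K + int n)"
    using IH[of "k - int n"] by (simp add: K_def algebra_simps)
  moreover have "conv (overlap a b nu lam) v k = conv (overlap (- b) (- a) nu lam) v' K"
    using IH[of k] by (simp add: K_def)
  moreover have "int (pweight nu) + int (pweight (lam(n := Suc (lam n)))) - T - k = K + int n"
    using pweight_Suc[OF valid(2), of n] by (simp add: K_def)
  ultimately show ?thesis
    unfolding conv_overlap_Suc[OF ab v(1) valid]
    by (simp add: conv_overlap_Suc[OF ab' v(2) valid] mult.assoc)
qed

text \<open>Exchanges the charges in the first factor only. The second factor is an arbitrary pair
  \<open>v\<close>, \<open>v'\<close>, constrained just by \<open>base\<close>, so that the lemma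
  can serve both tensor factors in turn.\<close>

lemma conv_overlap_swap_left:
  assumes ab: "\<bar>a * b\<bar> < 1 / 2" and v: "l2 v" "l2 v'"
    and base: "\<And>k. conv (vacuum a b) v k = conv (vacuum a b) v' (- T - k)"
    and valid: "valid_part nu" "valid_part lam"
  shows "conv (overlap a b nu lam) v k
    = conv (overlap (- b) (- a) nu lam) v' (int (pweight nu) + int (pweight lam) - T - k)"
  using valid(2,1)
proof (induction lam arbitrary: nu k rule: valid_part_induct)
  case zero
  then show ?case
  proof (induction arbitrary: k rule: valid_part_induct)
    case zero
    then show ?case
      using base[of k] vacuum_cong[of a b "- b" "- a"] by (simp add: vacuum_def)
  next
    case (Suc nu n)
    have ba: "\<bar>b * a\<bar> < 1 / 2" using ab by (simp add: mult.commute)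
    note comm = overlap_commute[of a b _ "\<lambda>_. 0"] overlap_commute[of "- b" "- a" _ "\<lambda>_. 0"]
    have "conv (overlap b a (\<lambda>_. 0) (nu(n := Suc (nu n)))) v k
        = conv (overlap (- a) (- b) (\<lambda>_. 0) (nu(n := Suc (nu n)))) v'
            (int (pweight (\<lambda>_. 0)) + int (pweight (nu(n := Suc (nu n)))) - T - k)"
    proof (rule conv_overlap_swap_Suc[OF ba v valid_part_zero Suc.hyps])
      show "conv (overlap b a (\<lambda>_. 0) nu) v k = conv (overlap (- a) (- b) (\<lambda>_. 0) nu) v'
          (int (pweight (\<lambda>_. 0)) + int (pweight nu) - T - k)" for k
        using Suc.IH[of k] by (simp add: comm)
    qed simp
    then show ?case by (simp only: comm add.commute[of _ "int (pweight (\<lambda>_. 0))"])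
  qed
next
  case (Suc lam n)
  show ?case
    by (intro conv_overlap_swap_Suc ab v Suc valid_part_upd)
qed

lemma conv_overlap_swap:
  assumes ab: "\<bar>a * b\<bar> < 1 / 2"
    and valid: "valid_part nu" "valid_part lam" "valid_part nu'" "valid_part lam'"
  shows "conv (overlap a b nu lam) (overlap a b nu' lam') k
    = conv (overlap (- b) (- a) nu lam) (overlap (- b) (- a) nu' lam')
        (int (pweight nu) + int (pweight lam) - (int (pweight nu') + int (pweight lam')) - k)"
proof (rule conv_overlap_swap_left[OF ab _ _ _ valid(1,2)])
  have ab': "\<bar>(- b) * (- a)\<bar> < 1 / 2" using ab by (simp add: mult.commute)
  show "l2 (overlap a b nu' lam')" "l2 (overlap (- b) (- a) nu' lam')"
    by (intro l2_overlap ab ab' valid)+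
  show "conv (vacuum a b) (overlap a b nu' lam') k
      = conv (vacuum a b) (overlap (- b) (- a) nu' lam') (- (int (pweight nu') + int (pweight lam')) - k)"
    for k
  proof -
    \<comment> \<open>The \<open>base\<close> premise of the first use is a second use with the two
      factors interchanged. Its own \<open>base\<close>, with offset 0, is the evenness of the
      autocorrelation of the vacuum overlap.\<close>
    have "conv (overlap a b nu' lam') (vacuum a b) (- k)
        = conv (overlap (- b) (- a) nu' lam') (vacuum a b)
            (int (pweight nu') + int (pweight lam') - 0 - (- k))"
      by (rule conv_overlap_swap_left[OF ab l2_vacuum[OF ab] l2_vacuum[OF ab] _ valid(3,4)])
         (use conv_commute[of "vacuum a b" "vacuum a b"] in simp)
    then show ?thesis
      by (simp add: conv_commute[of "vacuum a b" "overlap a b nu' lam'"]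
          conv_commute[of "vacuum a b" "overlap (- b) (- a) nu' lam'"] algebra_simps)
  qed
qed

section \<open>The tensor fields\<close>

definition level_pairs :: "int \<Rightarrow> (part \<times> part) set" where
  "level_pairs k = {(mu, mu'). valid_part mu \<and> valid_part mu' \<and> int (pweight mu) - int (pweight mu') = k}"

text \<open>Splits an infinite set of pairs into finite blocks by the weight \<open>N\<close> of the
  first component; the second component then has weight \<open>N - k\<close>.\<close>

lemma bij_level_pairs: "bij_betw snd (Sigma UNIV (\<lambda>N. parts N \<times> parts (N - k))) (level_pairs k)"
  by (rule bij_betw_byWitness[where f' = "\<lambda>p. (int (pweight (fst p)), p)"])
     (auto simp: level_pairs_def parts_def)

lemma has_sum_parts_prod:
  fixes p q :: "part \<Rightarrow> real"
  shows "((\<lambda>y. p (fst y) * q (snd y)) has_sum sum p (parts N) * sum q (parts K)) (parts N \<times> parts K)"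
  by (rule has_sum_finiteI)
     (simp_all add: finite_parts sum_product sum.cartesian_product case_prod_unfold)

lemma summable_on_level_pairs:
  fixes p q :: "part \<Rightarrow> real"
  assumes "\<And>mu. p mu \<ge> 0" "\<And>mu. q mu \<ge> 0"
    and "l2 (\<lambda>N. sum p (parts N))" "l2 (\<lambda>N. sum q (parts N))"
  shows "(\<lambda>y. p (fst y) * q (snd y)) summable_on level_pairs k"
proof -
  have "(\<lambda>y. p (fst (snd y)) * q (snd (snd y))) summable_on Sigma UNIV (\<lambda>N. parts N \<times> parts (N - k))"
  proof (rule summable_on_SigmaI)
    show "((\<lambda>y. p (fst (snd (N, y))) * q (snd (snd (N, y)))) has_sum
        sum p (parts N) * sum q (parts (N - k))) (parts N \<times> parts (N - k))" for N
      using has_sum_parts_prod by simp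
    show "(\<lambda>N. sum p (parts N) * sum q (parts (N - k))) summable_on UNIV"
      by (rule l2_mult_summable[OF assms(3) l2_shift[OF assms(4)]])
  qed (use assms in auto)
  then show ?thesis
    using summable_on_reindex_bij_betw[OF bij_level_pairs, of "\<lambda>y. p (fst y) * q (snd y)"]
    by simp
qed

text \<open>The terms may change sign, so the regrouping into blocks requires unordered summability
  as a premise; \<open>summable_on_level_pairs\<close> derives it only for nonnegative
  \<open>p\<close> and \<open>q\<close>.\<close>

lemma has_sum_level_pairs:
  fixes p q :: "part \<Rightarrow> real"
  assumes "(\<lambda>y. p (fst y) * q (snd y)) summable_on level_pairs k"
  shows "((\<lambda>y. p (fst y) * q (snd y)) has_sum
    conv (\<lambda>N. sum p (parts N)) (\<lambda>N. sum q (parts N)) k) (level_pairs k)"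
proof -
  let ?S = "infsum (\<lambda>y. p (fst y) * q (snd y)) (level_pairs k)"
  have S: "((\<lambda>y. p (fst y) * q (snd y)) has_sum ?S) (level_pairs k)"
    using assms by (rule has_sum_infsum)
  then have "((\<lambda>y. p (fst (snd y)) * q (snd (snd y))) has_sum ?S)
      (Sigma UNIV (\<lambda>N. parts N \<times> parts (N - k)))"
    using has_sum_reindex_bij_betw[OF bij_level_pairs, of "\<lambda>y. p (fst y) * q (snd y)"] by simp
  then have "((\<lambda>N. sum p (parts N) * sum q (parts (N - k))) has_sum ?S) UNIV"
    by (rule has_sum_SigmaD) (use has_sum_parts_prod in simp)
  from infsumI[OF this] S show ?thesis
    by (simp add: conv_def)
qed

lemma abs_mult_less_half:
  fixes a b :: real
  assumes "\<bar>a\<bar> < 1 / sqrt 2" "\<bar>b\<bar> < 1 / sqrt 2"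
  shows "\<bar>a * b\<bar> < 1 / 2"
proof -
  have "\<bar>a\<bar> * \<bar>b\<bar> < 1 / sqrt 2 * (1 / sqrt 2)"
    using assms by (intro mult_strict_mono) auto
  then show ?thesis by (simp add: abs_mult)
qed

text \<open>Absolute convergence comes from the diagonal overlaps \<open>(a, a)\<close> and \<open>(b, b)\<close>; this is where
  both charges must be below $1/\sqrt 2$, not just their product below $1/2$.\<close>

lemma has_sum_overlap_pairs:
  assumes "\<bar>a\<bar> < 1 / sqrt 2" "\<bar>b\<bar> < 1 / sqrt 2"
    and valid: "valid_part nu" "valid_part nu'" "valid_part lam" "valid_part lam'"
  shows "((\<lambda>y. (ycoef a nu (fst y) * ycoef b lam (fst y) * pnorm2 (fst y))
      * (ycoef a nu' (snd y) * ycoef b lam' (snd y) * pnorm2 (snd y))) has_sum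
    conv (overlap a b nu lam) (overlap a b nu' lam') k) (level_pairs k)"
proof -
  have sqsum: "(\<lambda>y. ((ycoef c r (fst y))\<^sup>2 * pnorm2 (fst y)) * ((ycoef c r' (snd y))\<^sup>2 * pnorm2 (snd y)))
      summable_on level_pairs k"
    if c: "\<bar>c\<bar> < 1 / sqrt 2" and r: "valid_part r" "valid_part r'" for c r r'
  proof (rule summable_on_level_pairs)
    have "(\<lambda>N. \<Sum>mu\<in>parts N. (ycoef c r mu)\<^sup>2 * pnorm2 mu) = overlap c c r r" for r
      by (simp add: overlap_def fun_eq_iff power2_eq_square)
    then show "l2 (\<lambda>N. \<Sum>mu\<in>parts N. (ycoef c r mu)\<^sup>2 * pnorm2 mu)"
        "l2 (\<lambda>N. \<Sum>mu\<in>parts N. (ycoef c r' mu)\<^sup>2 * pnorm2 mu)"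
      using l2_overlap[OF abs_mult_less_half[OF c c]] r by auto
  qed (simp_all add: pnorm2_nonneg)
  \<comment> \<open>The inequality of arithmetic and geometric means is applied to
    \<open>x * x'\<close> and \<open>y * y'\<close>. Each summand of the bound then involves one
    charge only and is controlled by diagonal overlaps.\<close>
  have bound: "\<bar>x * y * w * (x' * y' * w')\<bar> \<le> (x\<^sup>2 * w) * (x'\<^sup>2 * w') + (y\<^sup>2 * w) * (y'\<^sup>2 * w')"
    if "w \<ge> 0" "w' \<ge> 0" for x y w x' y' w' :: real
  proof -
    have "\<bar>(x * x') * (y * y')\<bar> \<le> (x * x')\<^sup>2 + (y * y')\<^sup>2"
      using sum_squares_bound[of "\<bar>x * x'\<bar>" "\<bar>y * y'\<bar>"]
        mult_nonneg_nonneg[OF abs_ge_zero abs_ge_zero, of "x * x'" "y * y'"]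
      unfolding abs_mult[of "x * x'" "y * y'"] power2_abs by linarith
    then have "\<bar>(x * x') * (y * y')\<bar> * (w * w') \<le> ((x * x')\<^sup>2 + (y * y')\<^sup>2) * (w * w')"
      using that by (intro mult_right_mono) auto
    then show ?thesis
      using that by (simp add: abs_mult power_mult_distrib algebra_simps)
  qed
  have "(\<lambda>y. (ycoef a nu (fst y) * ycoef b lam (fst y) * pnorm2 (fst y))
      * (ycoef a nu' (snd y) * ycoef b lam' (snd y) * pnorm2 (snd y))) summable_on level_pairs k"
  proof (rule abs_summable_summable, rule summable_on_comparison_test)
    show "(\<lambda>y. ((ycoef a nu (fst y))\<^sup>2 * pnorm2 (fst y)) * ((ycoef a nu' (snd y))\<^sup>2 * pnorm2 (snd y))
        + ((ycoef b lam (fst y))\<^sup>2 * pnorm2 (fst y)) * ((ycoef b lam' (snd y))\<^sup>2 * pnorm2 (snd y)))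
        summable_on level_pairs k"
      by (intro summable_on_add sqsum assms)
  qed (simp_all only: real_norm_def bound pnorm2_nonneg abs_ge_zero)
  from has_sum_level_pairs[OF this] show ?thesis
    by (simp add: overlap_def[abs_def])
qed

section \<open>Matrix elements of one tensor field, and the adjoint relation\<close>

definition diag_label :: "(int \<times> part) \<times> (int \<times> part) \<Rightarrow> bool" where
  "diag_label b \<longleftrightarrow> fst (fst b) = fst (snd b) \<and> valid_part (snd (fst b)) \<and> valid_part (snd (snd b))"

definition level :: "(int \<times> part) \<times> (int \<times> part) \<Rightarrow> int" where
  "level b = int (pweight (snd (fst b))) - int (pweight (snd (snd b)))"

definition Phimat ::
  "real \<Rightarrow> real \<Rightarrow> int \<Rightarrow> (int \<times> part) \<times> (int \<times> part) \<Rightarrow> (int \<times> part) \<times> (int \<times> part) \<Rightarrow> real" where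
  "Phimat \<alpha>0 \<alpha> s c b =
    (if diag_label c \<and> of_int (fst (fst c)) * \<alpha>0 = of_int (fst (fst b)) * \<alpha>0 + \<alpha> \<and> level b - level c = s
     then ycoef \<alpha> (snd (fst b)) (snd (fst c)) * ycoef \<alpha> (snd (snd b)) (snd (snd c)) else 0)"

lemma DomD:
  assumes "\<Psi> \<in> Dom"
  shows "finite {b. \<Psi> b \<noteq> 0}" "\<And>b. \<Psi> b \<noteq> 0 \<Longrightarrow> diag_label b"
  using assms by (auto simp: Dom_def diag_label_def)

text \<open>For given basis labels the first \<open>Ymat\<close> is nonzero for at most one
  \<open>t\<close>, so the sum over \<open>t\<close> collapses. In the difference of the two mode
  numbers the charge terms cancel, which leaves the integer condition
  \<open>level b - level c = s\<close>.\<close>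

lemma Phi_eq_sum:
  assumes "\<alpha>0 \<noteq> 0" "\<Psi> \<in> Dom"
  shows "Phi \<alpha>0 \<alpha> s \<Psi> c = (\<Sum>b\<in>{b. \<Psi> b \<noteq> 0}. of_real (Phimat \<alpha>0 \<alpha> s c b) * \<Psi> b)"
  unfolding Phi_def
proof (intro infsumI has_sum_sum DomD(1)[OF assms(2)])
  fix b assume "b \<in> {b. \<Psi> b \<noteq> 0}"
  then have b: "diag_label b" using DomD(2)[OF assms(2)] by simp
  obtain j lam lam' where b_eq: "b = ((j, lam), (j, lam'))"
    and valid: "valid_part lam" "valid_part lam'"
    using b by (cases b) (auto simp: diag_label_def)
  obtain i mu i' mu' where c_eq: "c = ((i, mu), (i', mu'))" by (metis prod.exhaust)
  define t0 where "t0 = real (pweight lam) - real (pweight mu) - \<alpha> * (of_int j * \<alpha>0) - \<alpha>\<^sup>2 / 2"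
  define t1 where "t1 = real (pweight lam') - real (pweight mu') - \<alpha> * (of_int j * \<alpha>0) - \<alpha>\<^sup>2 / 2"
  have lev: "t0 - of_int s = t1 \<longleftrightarrow> level b - level c = s"
  proof -
    have "t0 - of_int s = t1 \<longleftrightarrow> real_of_int (level b - level c) = of_int s"
      by (auto simp: t0_def t1_def level_def b_eq c_eq)
    then show ?thesis by (simp only: of_int_eq_iff)
  qed
  \<comment> \<open>As \<open>\<alpha>0 \<noteq> 0\<close>, the charge determines the sector, so the
    image label is again diagonal.\<close>
  have charge: "of_int i' * \<alpha>0 = of_int j * \<alpha>0 + \<alpha> \<longleftrightarrow> i' = i"
    if "of_int i * \<alpha>0 = of_int j * \<alpha>0 + \<alpha>"
    using that assms(1) by (metis mult_right_cancel of_int_eq_iff)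
  have "Ymat \<alpha>0 \<alpha> t0 (fst c) (fst b) * Ymat \<alpha>0 \<alpha> (t0 - of_int s) (snd c) (snd b) = Phimat \<alpha>0 \<alpha> s c b"
    using lev charge valid
    by (auto simp: Ymat_def Phimat_def diag_label_def b_eq c_eq t0_def[symmetric] t1_def[symmetric])
  moreover have "Ymat \<alpha>0 \<alpha> t (fst c) (fst b) = 0" if "t \<noteq> t0" for t
    using that by (auto simp: Ymat_def b_eq c_eq t0_def)
  ultimately show "((\<lambda>t. complex_of_real (Ymat \<alpha>0 \<alpha> t (fst c) (fst b)
      * Ymat \<alpha>0 \<alpha> (t - of_int s) (snd c) (snd b)) * \<Psi> b) has_sum of_real (Phimat \<alpha>0 \<alpha> s c b) * \<Psi> b) UNIV"
    by (intro has_sum_finite_neutralI[where B = "{t0}"]) auto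
qed

lemma Phimat_adjoint:
  assumes "diag_label b" "diag_label c"
  shows "Phimat \<alpha>0 \<alpha> s c b * (pnorm2 (snd (fst c)) * pnorm2 (snd (snd c)))
    = Phimat \<alpha>0 (- \<alpha>) (- s) b c * (pnorm2 (snd (fst b)) * pnorm2 (snd (snd b)))"
proof -
  have "ycoef \<alpha> (snd (fst b)) (snd (fst c)) * pnorm2 (snd (fst c))
      = ycoef (- \<alpha>) (snd (fst c)) (snd (fst b)) * pnorm2 (snd (fst b))"
    "ycoef \<alpha> (snd (snd b)) (snd (snd c)) * pnorm2 (snd (snd c))
      = ycoef (- \<alpha>) (snd (snd c)) (snd (snd b)) * pnorm2 (snd (snd b))"
    using assms by (auto intro!: ycoef_adjoint simp: diag_label_def)
  then have "(ycoef \<alpha> (snd (fst b)) (snd (fst c)) * pnorm2 (snd (fst c)))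
      * (ycoef \<alpha> (snd (snd b)) (snd (snd c)) * pnorm2 (snd (snd c)))
      = (ycoef (- \<alpha>) (snd (fst c)) (snd (fst b)) * pnorm2 (snd (fst b)))
      * (ycoef (- \<alpha>) (snd (snd c)) (snd (snd b)) * pnorm2 (snd (snd b)))"
    by simp
  then show ?thesis
    using assms by (auto simp: Phimat_def mult_ac)
qed

lemma tinner_Phi_adjoint:
  assumes "\<alpha>0 \<noteq> 0" "\<Psi>1 \<in> Dom" "\<Psi>2 \<in> Dom"
  shows "tinner \<Psi>1 (Phi \<alpha>0 \<alpha> s \<Psi>2) = tinner (Phi \<alpha>0 (- \<alpha>) (- s) \<Psi>1) \<Psi>2"
proof -
  let ?S1 = "{b. \<Psi>1 b \<noteq> 0}" and ?S2 = "{b. \<Psi>2 b \<noteq> 0}"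
  let ?w = "\<lambda>b. pnorm2 (snd (fst b)) * pnorm2 (snd (snd b))"
  note D1 = DomD[OF assms(2)] and D2 = DomD[OF assms(3)]
  \<comment> \<open>\<open>Phi \<alpha>0 \<alpha> s \<Psi>2\<close> may have infinite support, but
    pairing it with \<open>\<Psi>1\<close> leaves a finite sum.\<close>
  have "tinner \<Psi>1 (Phi \<alpha>0 \<alpha> s \<Psi>2)
      = (\<Sum>c\<in>?S1. cnj (\<Psi>1 c) * Phi \<alpha>0 \<alpha> s \<Psi>2 c * of_real (?w c))"
    unfolding tinner_def
    by (intro infsumI has_sum_finite_neutralI[OF D1(1)]) auto
  also have "\<dots> = (\<Sum>c\<in>?S1. \<Sum>b\<in>?S2. cnj (\<Psi>1 c) * \<Psi>2 b * of_real (Phimat \<alpha>0 \<alpha> s c b * ?w c))"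
    by (simp add: Phi_eq_sum[OF assms(1,3)] sum_distrib_left sum_distrib_right mult_ac)
  also have "\<dots> = (\<Sum>c\<in>?S1. \<Sum>b\<in>?S2. cnj (\<Psi>1 c) * \<Psi>2 b * of_real (Phimat \<alpha>0 (- \<alpha>) (- s) b c * ?w b))"
  proof (intro sum.cong refl)
    fix c b assume "c \<in> ?S1" "b \<in> ?S2"
    then have "diag_label b" "diag_label c" using D1(2) D2(2) by auto
    from Phimat_adjoint[OF this, of \<alpha>0 \<alpha> s]
    show "cnj (\<Psi>1 c) * \<Psi>2 b * of_real (Phimat \<alpha>0 \<alpha> s c b * ?w c)
        = cnj (\<Psi>1 c) * \<Psi>2 b * of_real (Phimat \<alpha>0 (- \<alpha>) (- s) b c * ?w b)"
      by (simp only:)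
  qed
  also have "\<dots> = (\<Sum>b\<in>?S2. \<Sum>c\<in>?S1. cnj (\<Psi>1 c) * \<Psi>2 b * of_real (Phimat \<alpha>0 (- \<alpha>) (- s) b c * ?w b))"
    by (rule sum.swap)
  also have "\<dots> = (\<Sum>b\<in>?S2. cnj (Phi \<alpha>0 (- \<alpha>) (- s) \<Psi>1 b) * \<Psi>2 b * of_real (?w b))"
    by (simp add: Phi_eq_sum[OF assms(1,2)] sum_distrib_left sum_distrib_right mult_ac)
  also have "\<dots> = tinner (Phi \<alpha>0 (- \<alpha>) (- s) \<Psi>1) \<Psi>2"
    unfolding tinner_def
    by (intro infsumI[symmetric] has_sum_finite_neutralI[OF D2(1)]) auto
  finally show ?thesis .
qed

section \<open>Inner products of two transformed vectors, and weak commutativity\<close>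

definition Phi_product ::
  "real \<Rightarrow> real \<Rightarrow> int \<Rightarrow> real \<Rightarrow> int \<Rightarrow> (int \<times> part) \<times> (int \<times> part) \<Rightarrow> (int \<times> part) \<times> (int \<times> part) \<Rightarrow> real" where
  "Phi_product \<alpha>0 a s b t p q =
    (if of_int (fst (fst p)) * \<alpha>0 + a = of_int (fst (fst q)) * \<alpha>0 + b \<and> level p - s = level q - t
     then conv (overlap a b (snd (fst p)) (snd (fst q))) (overlap a b (snd (snd p)) (snd (snd q))) (level p - s)
     else 0)"

text \<open>The intermediate labels \<open>c\<close> that contribute all lie in one sector and at
  one level, hence are parametrized by \<open>level_pairs\<close>;
  \<open>has_sum_overlap_pairs\<close> evaluates the sum over them.\<close>

lemma has_sum_Phi_product:
  assumes "\<alpha>0 \<noteq> 0" and a: "a = of_int ka * \<alpha>0"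
    and small: "\<bar>a\<bar> < 1 / sqrt 2" "\<bar>b\<bar> < 1 / sqrt 2"
    and diag: "diag_label p" "diag_label q"
  shows "((\<lambda>c. Phimat \<alpha>0 a s c p * Phimat \<alpha>0 b t c q * (pnorm2 (snd (fst c)) * pnorm2 (snd (snd c))))
    has_sum Phi_product \<alpha>0 a s b t p q) UNIV"
proof (cases "of_int (fst (fst p)) * \<alpha>0 + a = of_int (fst (fst q)) * \<alpha>0 + b \<and> level p - s = level q - t")
  case False
  then have "Phimat \<alpha>0 a s c p * Phimat \<alpha>0 b t c q = 0" for c
    by (auto simp: Phimat_def)
  moreover have "Phi_product \<alpha>0 a s b t p q = 0"
    unfolding Phi_product_def by (rule if_not_P[OF False])
  ultimately show ?thesis
    by (simp only: mult_zero_left has_sum_0)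
next
  case True
  define k where "k = level p - s"
  \<comment> \<open>The common sector of the intermediate states; it exists because \<open>a\<close>
    is an integer multiple of \<open>\<alpha>0\<close>.\<close>
  define i where "i = fst (fst p) + ka"
  let ?emb = "\<lambda>y :: part \<times> part. ((i, fst y), (i, snd y))"
  let ?f = "\<lambda>c. Phimat \<alpha>0 a s c p * Phimat \<alpha>0 b t c q * (pnorm2 (snd (fst c)) * pnorm2 (snd (snd c)))"
  have i: "of_int i * \<alpha>0 = of_int (fst (fst p)) * \<alpha>0 + a"
    by (simp add: i_def a algebra_simps)
  have inj: "inj_on ?emb (level_pairs k)"
    by (auto simp: inj_on_def prod_eq_iff)
  have f_emb: "?f (?emb y) = (ycoef a (snd (fst p)) (fst y) * ycoef b (snd (fst q)) (fst y) * pnorm2 (fst y))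
      * (ycoef a (snd (snd p)) (snd y) * ycoef b (snd (snd q)) (snd y) * pnorm2 (snd y))"
    if "y \<in> level_pairs k" for y
  proof -
    have y: "diag_label (?emb y)" "level (?emb y) = k"
      using that by (auto simp: level_pairs_def diag_label_def level_def)
    then show ?thesis
      using True i by (simp add: Phimat_def k_def)
  qed
  have "((\<lambda>y. (ycoef a (snd (fst p)) (fst y) * ycoef b (snd (fst q)) (fst y) * pnorm2 (fst y))
      * (ycoef a (snd (snd p)) (snd y) * ycoef b (snd (snd q)) (snd y) * pnorm2 (snd y))) has_sum
      Phi_product \<alpha>0 a s b t p q) (level_pairs k)"
    using has_sum_overlap_pairs[OF small, of "snd (fst p)" "snd (snd p)" "snd (fst q)" "snd (snd q)" k]
      diag True by (simp add: Phi_product_def k_def diag_label_def)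
  then have "((\<lambda>y. ?f (?emb y)) has_sum Phi_product \<alpha>0 a s b t p q) (level_pairs k)"
    by (subst has_sum_cong[OF f_emb])
  then have sum: "(?f has_sum Phi_product \<alpha>0 a s b t p q) (?emb ` level_pairs k)"
    by (subst has_sum_reindex[OF inj]) (simp only: o_def)
  have supp: "?f c = 0" if "c \<notin> ?emb ` level_pairs k" for c
  proof (rule ccontr)
    assume "?f c \<noteq> 0"
    then have nz: "Phimat \<alpha>0 a s c p \<noteq> 0" by auto
    then have c: "diag_label c" "of_int (fst (fst c)) * \<alpha>0 = of_int i * \<alpha>0" "level c = k"
      using i by (auto simp: Phimat_def k_def split: if_splits)
    then have "fst (fst c) = i" using assms(1) by simp
    then have "c = ?emb (snd (fst c), snd (snd c))" "(snd (fst c), snd (snd c)) \<in> level_pairs k"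
      using c by (auto simp: diag_label_def level_def level_pairs_def prod_eq_iff)
    then show False using that by blast
  qed
  show ?thesis
    by (rule has_sum_cong_neutral[THEN iffD1, OF _ _ _ sum]) (use supp in auto)
qed

text \<open>The exchange takes the charges \<open>(- \<alpha>, \<beta>)\<close> to
  \<open>(- \<beta>, \<alpha>)\<close>. By the level condition, the reflection of the lag
  \<open>level p + m\<close> is \<open>level q - m = level p + n\<close>, the lag of the opposite
  order. The selection rules of the two orders are equivalent by rearrangement.\<close>

lemma Phi_product_swap:
  assumes ab: "\<bar>\<alpha> * \<beta>\<bar> < 1 / 2" and diag: "diag_label p" "diag_label q"
  shows "Phi_product \<alpha>0 (- \<alpha>) (- m) \<beta> n p q = Phi_product \<alpha>0 (- \<beta>) (- n) \<alpha> m p q"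
proof (cases "of_int (fst (fst p)) * \<alpha>0 - \<alpha> = of_int (fst (fst q)) * \<alpha>0 + \<beta> \<and> level p + m = level q - n")
  case True
  have ab': "\<bar>(- \<alpha>) * \<beta>\<bar> < 1 / 2" using ab by simp
  have lev: "int (pweight (snd (fst p))) + int (pweight (snd (fst q)))
      - (int (pweight (snd (snd p))) + int (pweight (snd (snd q)))) - (level p + m) = level p + n"
    using True by (simp add: level_def)
  have "Phi_product \<alpha>0 (- \<alpha>) (- m) \<beta> n p q = conv (overlap (- \<alpha>) \<beta> (snd (fst p)) (snd (fst q)))
      (overlap (- \<alpha>) \<beta> (snd (snd p)) (snd (snd q))) (level p + m)"
    using True by (simp add: Phi_product_def)
  also have "\<dots> = conv (overlap (- \<beta>) \<alpha> (snd (fst p)) (snd (fst q)))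
      (overlap (- \<beta>) \<alpha> (snd (snd p)) (snd (snd q))) (level p + n)"
    using conv_overlap_swap[OF ab', of "snd (fst p)" "snd (fst q)" "snd (snd p)" "snd (snd q)" "level p + m"]
      diag unfolding lev by (simp add: diag_label_def)
  also have "\<dots> = Phi_product \<alpha>0 (- \<beta>) (- n) \<alpha> m p q"
    using True by (auto simp: Phi_product_def)
  finally show ?thesis .
next
  case False
  then have "\<not> (of_int (fst (fst p)) * \<alpha>0 - \<beta> = of_int (fst (fst q)) * \<alpha>0 + \<alpha> \<and> level p + n = level q - m)"
    by (auto simp: algebra_simps)
  then show ?thesis using False by (auto simp: Phi_product_def)
qed

text \<open>Reduction to basis vectors: both supports are finite and each pair of labels has a
  convergent sum over \<open>c\<close>, so the finite sums may be taken outside.\<close>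

lemma tinner_Phi_Phi:
  assumes "\<alpha>0 \<noteq> 0" and a: "a = of_int ka * \<alpha>0"
    and small: "\<bar>a\<bar> < 1 / sqrt 2" "\<bar>b\<bar> < 1 / sqrt 2"
    and dom: "\<Psi>1 \<in> Dom" "\<Psi>2 \<in> Dom"
  shows "tinner (Phi \<alpha>0 a s \<Psi>1) (Phi \<alpha>0 b t \<Psi>2)
    = (\<Sum>p\<in>{p. \<Psi>1 p \<noteq> 0}. \<Sum>q\<in>{q. \<Psi>2 q \<noteq> 0}. cnj (\<Psi>1 p) * \<Psi>2 q * of_real (Phi_product \<alpha>0 a s b t p q))"
proof -
  note D1 = DomD[OF dom(1)] and D2 = DomD[OF dom(2)]
  have "((\<lambda>c. \<Sum>p\<in>{p. \<Psi>1 p \<noteq> 0}. \<Sum>q\<in>{q. \<Psi>2 q \<noteq> 0}. cnj (\<Psi>1 p) * \<Psi>2 q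
      * of_real (Phimat \<alpha>0 a s c p * Phimat \<alpha>0 b t c q * (pnorm2 (snd (fst c)) * pnorm2 (snd (snd c)))))
    has_sum (\<Sum>p\<in>{p. \<Psi>1 p \<noteq> 0}. \<Sum>q\<in>{q. \<Psi>2 q \<noteq> 0}. cnj (\<Psi>1 p) * \<Psi>2 q
      * of_real (Phi_product \<alpha>0 a s b t p q))) UNIV"
    using D1 D2
    by (intro has_sum_sum has_sum_cmult_right has_sum_of_real has_sum_Phi_product[OF assms(1) a small]) auto
  moreover have "cnj (Phi \<alpha>0 a s \<Psi>1 c) * Phi \<alpha>0 b t \<Psi>2 c
      * of_real (pnorm2 (snd (fst c)) * pnorm2 (snd (snd c)))
    = (\<Sum>p\<in>{p. \<Psi>1 p \<noteq> 0}. \<Sum>q\<in>{q. \<Psi>2 q \<noteq> 0}. cnj (\<Psi>1 p) * \<Psi>2 q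
      * of_real (Phimat \<alpha>0 a s c p * Phimat \<alpha>0 b t c q * (pnorm2 (snd (fst c)) * pnorm2 (snd (snd c)))))" for c
    unfolding Phi_eq_sum[OF assms(1) dom(1)] Phi_eq_sum[OF assms(1) dom(2)]
      cnj_sum sum_distrib_right
    by (intro sum.cong refl) (simp add: sum_distrib_left sum_distrib_right mult_ac)
  ultimately show ?thesis
    unfolding tinner_def by (simp only: infsumI)
qed

theorem mainTheorem4:
  fixes \<alpha>0 \<alpha> \<beta> :: real
  assumes "0 < \<bar>\<alpha>0\<bar>" and "\<bar>\<alpha>0\<bar> \<le> 1"
    and "\<alpha> \<in> {of_int k * \<alpha>0 | k. True}" and "\<beta> \<in> {of_int k * \<alpha>0 | k. True}"
    and "\<bar>\<alpha>\<bar> < 1 / sqrt 2" and "\<bar>\<beta>\<bar> < 1 / sqrt 2"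
  shows "(\<forall>s::int. \<forall>\<Psi>1\<in>Dom. \<forall>\<Psi>2\<in>Dom.
            tinner \<Psi>1 (Phi \<alpha>0 \<alpha> s \<Psi>2) = tinner (Phi \<alpha>0 (- \<alpha>) (- s) \<Psi>1) \<Psi>2)
       \<and> (\<forall>m n :: int. \<forall>\<Psi>1\<in>Dom. \<forall>\<Psi>2\<in>Dom.
            tinner (Phi \<alpha>0 (- \<alpha>) (- m) \<Psi>1) (Phi \<alpha>0 \<beta> n \<Psi>2)
          = tinner (Phi \<alpha>0 (- \<beta>) (- n) \<Psi>1) (Phi \<alpha>0 \<alpha> m \<Psi>2))"
proof (intro conjI allI ballI)
  have nz: "\<alpha>0 \<noteq> 0" using assms(1) by auto
  show "tinner \<Psi>1 (Phi \<alpha>0 \<alpha> s \<Psi>2) = tinner (Phi \<alpha>0 (- \<alpha>) (- s) \<Psi>1) \<Psi>2"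
    if "\<Psi>1 \<in> Dom" "\<Psi>2 \<in> Dom" for s \<Psi>1 \<Psi>2
    using tinner_Phi_adjoint[OF nz that] .
  fix m n \<Psi>1 \<Psi>2 assume dom: "\<Psi>1 \<in> Dom" "\<Psi>2 \<in> Dom"
  obtain ka kb where "\<alpha> = of_int ka * \<alpha>0" "\<beta> = of_int kb * \<alpha>0"
    using assms(3,4) by auto
  then have minus: "- \<alpha> = of_int (- ka) * \<alpha>0" "- \<beta> = of_int (- kb) * \<alpha>0"
    by simp_all
  have small: "\<bar>- \<alpha>\<bar> < 1 / sqrt 2" "\<bar>- \<beta>\<bar> < 1 / sqrt 2"
    using assms(5,6) by simp_all
  show "tinner (Phi \<alpha>0 (- \<alpha>) (- m) \<Psi>1) (Phi \<alpha>0 \<beta> n \<Psi>2)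
      = tinner (Phi \<alpha>0 (- \<beta>) (- n) \<Psi>1) (Phi \<alpha>0 \<alpha> m \<Psi>2)"
    unfolding tinner_Phi_Phi[OF nz minus(1) small(1) assms(6) dom]
      tinner_Phi_Phi[OF nz minus(2) small(2) assms(5) dom]
    using DomD(2)[OF dom(1)] DomD(2)[OF dom(2)]
    by (intro sum.cong refl) (simp add: Phi_product_swap[OF abs_mult_less_half[OF assms(5,6)]])
qed

end
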